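(* Let $\mathfrak g$ be a four dimensional real Lie algebra. If $\mathfrak g$ is a solution of the cotangent extension problem, then $\mathfrak g$ is either a completely solvable symplectic Lie algebra or isomorphic to $\mathfrak{aff}(\mathbb C)$ (viewed as a real Lie algebra).
   Context: A symplectic form on a $2n$-dimensional real Lie algebra is a closed (Chevalley–Eilenberg, trivial coefficients) 2-form $\omega$ with $\omega^n\neq0$; a Lie algebra is symplectic if it admits one. A solvable real Lie algebra $\mathfrak g$ is completely solvable if $\operatorname{ad}_x$ has only real eigenvalues for all $x\in\mathfrak g$. The Lie algebra $\mathfrak{aff}(\mathbb C)$, regarded as a real Lie algebra, has basis $e_1,\dots,e_4$ with nonzero brackets $[e_1,e_3]=e_3$, $[e_1,e_4]=e_4$, $[e_2,e_3]=e_4$, $[e_2,e_4]=-e_3$. Cotangent extension problem: for a Lie algebra $\mathfrak h$ with dual space $\mathfrak h^*$, let $\omega_0((\varphi,x),(\varphi',x'))=\varphi(x')-\varphi'(x)$ on $\mathfrak h^*\oplus\mathfrak h$. One looks for Lie algebra structures on the vector space $\mathfrak h^*\oplus\mathfrak h$ such that (c1) $0\to\mathfrak h^*\to\mathfrak h^*\oplus\mathfrak h\to\mathfrak h\to0$ (canonical inclusion and projection) is an exact sequence of Lie algebras, $\mathfrak h^*$ being abelian; and (c2) $\omega_0$ is closed. A symplectic Lie algebra $(\mathfrak g,\omega)$ is a solution of the cotangent extension problem if there is a Lie algebra isomorphism, carrying $\omega$ to $\omega_0$, from $\mathfrak g$ onto some $\mathfrak h^*\oplus\mathfrak h$ with a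 Lie algebra structure satisfying (c1) and (c2). A Lie algebra $\mathfrak g$ is called a solution if $(\mathfrak g,\omega)$ is one for some symplectic form $\omega$. *)

theory Defs
  imports "HOL-Analysis.Analysis"
begin

section \<open>Real Lie algebras\<close>

text \<open>A Lie algebra is a bracket on a type of class \<open>real_vector\<close>; in particular it need not
  be finite-dimensional. Note that \<open>dim UNIV = 0\<close> for an infinite-dimensional type.\<close>

definition lie_algebra :: "('a::real_vector \<Rightarrow> 'a \<Rightarrow> 'a) \<Rightarrow> bool" where
  "lie_algebra br \<longleftrightarrow> bilinear br \<and> (\<forall>x. br x x = 0) \<and>
     (\<forall>x y z. br x (br y z) + br y (br z x) + br z (br x y) = 0)"

definition lie_hom ::
  "('a::real_vector \<Rightarrow> 'a \<Rightarrow> 'a) \<Rightarrow> ('b::real_vector \<Rightarrow> 'b \<Rightarrow> 'b) \<Rightarrow> ('a \<Rightarrow> 'b) \<Rightarrow> bool" where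
  "lie_hom br br' f \<longleftrightarrow> linear f \<and> (\<forall>x y. f (br x y) = br' (f x) (f y))"

definition lie_iso ::
  "('a::real_vector \<Rightarrow> 'a \<Rightarrow> 'a) \<Rightarrow> ('b::real_vector \<Rightarrow> 'b \<Rightarrow> 'b) \<Rightarrow> ('a \<Rightarrow> 'b) \<Rightarrow> bool" where
  "lie_iso br br' f \<longleftrightarrow> lie_hom br br' f \<and> bij f"

definition lie_isomorphic ::
  "('a::real_vector \<Rightarrow> 'a \<Rightarrow> 'a) \<Rightarrow> ('b::real_vector \<Rightarrow> 'b \<Rightarrow> 'b) \<Rightarrow> bool" where
  "lie_isomorphic br br' \<longleftrightarrow> (\<exists>f. lie_iso br br' f)"

definition lie_short_exact ::
  "('a::real_vector \<Rightarrow> 'a \<Rightarrow> 'a) \<Rightarrow> ('b::real_vector \<Rightarrow> 'b \<Rightarrow> 'b) \<Rightarrow> ('c::real_vector \<Rightarrow> 'c \<Rightarrow> 'c)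
    \<Rightarrow> ('a \<Rightarrow> 'b) \<Rightarrow> ('b \<Rightarrow> 'c) \<Rightarrow> bool" where
  "lie_short_exact brA brB brC i p \<longleftrightarrow>
     lie_hom brA brB i \<and> lie_hom brB brC p \<and> inj i \<and> range i = {b. p b = 0} \<and> surj p"

fun derived_series :: "('a::real_vector \<Rightarrow> 'a \<Rightarrow> 'a) \<Rightarrow> nat \<Rightarrow> 'a set" where
  "derived_series br 0 = UNIV"
| "derived_series br (Suc n) =
     span {br x y | x y. x \<in> derived_series br n \<and> y \<in> derived_series br n}"

definition solvable_lie :: "('a::real_vector \<Rightarrow> 'a \<Rightarrow> 'a) \<Rightarrow> bool" where
  "solvable_lie br \<longleftrightarrow> lie_algebra br \<and> (\<exists>n. derived_series br n = {0})"

text \<open>The complexification of a real vector space \<open>V\<close> is modelled as \<open>V \<times> V\<close>, with \<open>(u, v)\<close>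
  standing for \<open>u + \<i>v\<close>; a real endomorphism \<open>T\<close> extends to it as \<open>map_prod T T\<close>.\<close>

definition scaleC_complexification :: "complex \<Rightarrow> 'a::real_vector \<times> 'a \<Rightarrow> 'a \<times> 'a" where
  "scaleC_complexification z w =
     (Re z *\<^sub>R fst w - Im z *\<^sub>R snd w, Re z *\<^sub>R snd w + Im z *\<^sub>R fst w)"

definition complex_eigenvalue :: "('a::real_vector \<Rightarrow> 'a) \<Rightarrow> complex \<Rightarrow> bool" where
  "complex_eigenvalue T z \<longleftrightarrow> (\<exists>w. w \<noteq> 0 \<and> map_prod T T w = scaleC_complexification z w)"

definition completely_solvable :: "('a::real_vector \<Rightarrow> 'a \<Rightarrow> 'a) \<Rightarrow> bool" where
  "completely_solvable br \<longleftrightarrow>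
     solvable_lie br \<and> (\<forall>x z. complex_eigenvalue (br x) z \<longrightarrow> z \<in> \<real>)"


section \<open>Symplectic forms\<close>

definition two_form :: "('a::real_vector \<Rightarrow> 'a \<Rightarrow> real) \<Rightarrow> bool" where
  "two_form \<omega> \<longleftrightarrow> bilinear \<omega> \<and> (\<forall>x. \<omega> x x = 0)"

text \<open>Chevalley--Eilenberg differential of a 2-form, with trivial coefficients.\<close>

definition ce_diff ::
  "('a::real_vector \<Rightarrow> 'a \<Rightarrow> 'a) \<Rightarrow> ('a \<Rightarrow> 'a \<Rightarrow> real) \<Rightarrow> 'a \<Rightarrow> 'a \<Rightarrow> 'a \<Rightarrow> real" where
  "ce_diff br \<omega> x y z = - \<omega> (br x y) z + \<omega> (br x z) y - \<omega> (br y z) x"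

definition closed_two_form ::
  "('a::real_vector \<Rightarrow> 'a \<Rightarrow> 'a) \<Rightarrow> ('a \<Rightarrow> 'a \<Rightarrow> real) \<Rightarrow> bool" where
  "closed_two_form br \<omega> \<longleftrightarrow> two_form \<omega> \<and> (\<forall>x y z. ce_diff br \<omega> x y z = 0)"

text \<open>A \<open>k\<close>-form is represented as a function of a sequence of vectors depending only on the
  entries \<open>0, \<dots>, k - 1\<close>.\<close>

definition wedge ::
  "nat \<Rightarrow> nat \<Rightarrow> ((nat \<Rightarrow> 'a) \<Rightarrow> real) \<Rightarrow> ((nat \<Rightarrow> 'a) \<Rightarrow> real) \<Rightarrow> (nat \<Rightarrow> 'a) \<Rightarrow> real" where
  "wedge k l \<alpha> \<beta> v =
     (\<Sum>p | p permutes {..<k + l}.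
        of_int (sign p) * \<alpha> (\<lambda>i. v (p i)) * \<beta> (\<lambda>i. v (p (k + i)))) / (fact k * fact l)"

fun two_form_power :: "('a \<Rightarrow> 'a \<Rightarrow> real) \<Rightarrow> nat \<Rightarrow> (nat \<Rightarrow> 'a) \<Rightarrow> real" where
  "two_form_power \<omega> 0 = (\<lambda>v. 1)"
| "two_form_power \<omega> (Suc n) = wedge 2 (2 * n) (\<lambda>v. \<omega> (v 0) (v 1)) (two_form_power \<omega> n)"

definition symplectic_form ::
  "('a::real_vector \<Rightarrow> 'a \<Rightarrow> 'a) \<Rightarrow> ('a \<Rightarrow> 'a \<Rightarrow> real) \<Rightarrow> bool" where
  "symplectic_form br \<omega> \<longleftrightarrow> closed_two_form br \<omega> \<and>
     (\<exists>B::'a set. finite B \<and> span B = UNIV) \<and>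
     (\<exists>n. dim (UNIV :: 'a set) = 2 * n \<and> two_form_power \<omega> n \<noteq> (\<lambda>v. 0))"

definition symplectic_lie_algebra :: "('a::real_vector \<Rightarrow> 'a \<Rightarrow> 'a) \<Rightarrow> bool" where
  "symplectic_lie_algebra br \<longleftrightarrow> lie_algebra br \<and> (\<exists>\<omega>. symplectic_form br \<omega>)"


section \<open>The dual space\<close>

typedef (overloaded) 'a dual = "{f :: 'a::real_vector \<Rightarrow> real. linear f}"
  morphisms dual_apply Dual
  by (auto intro: linear_zero)

setup_lifting type_definition_dual

instantiation dual :: (real_vector) real_vector
begin

lift_definition zero_dual :: "'a dual" is "\<lambda>x. 0"
  by (rule linear_zero)

lift_definition plus_dual :: "'a dual \<Rightarrow> 'a dual \<Rightarrow> 'a dual" is "\<lambda>f g x. f x + g x"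
  by (rule linear_compose_add)

lift_definition minus_dual :: "'a dual \<Rightarrow> 'a dual \<Rightarrow> 'a dual" is "\<lambda>f g x. f x - g x"
  by (rule linear_compose_sub)

lift_definition uminus_dual :: "'a dual \<Rightarrow> 'a dual" is "\<lambda>f x. - f x"
  by (rule linear_compose_neg)

lift_definition scaleR_dual :: "real \<Rightarrow> 'a dual \<Rightarrow> 'a dual" is "\<lambda>c f x. c *\<^sub>R f x"
  by (rule linear_compose_scale_right)

instance
  by standard (transfer, simp add: fun_eq_iff algebra_simps)+

end


section \<open>The cotangent extension problem\<close>

definition canonical_two_form :: "'h::real_vector dual \<times> 'h \<Rightarrow> 'h dual \<times> 'h \<Rightarrow> real" where
  "canonical_two_form = (\<lambda>(\<phi>, x) (\<phi>', x'). dual_apply \<phi> x' - dual_apply \<phi>' x)"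

definition cotangent_extension ::
  "('h::real_vector \<Rightarrow> 'h \<Rightarrow> 'h) \<Rightarrow> ('h dual \<times> 'h \<Rightarrow> 'h dual \<times> 'h \<Rightarrow> 'h dual \<times> 'h) \<Rightarrow> bool" where
  "cotangent_extension hbr ebr \<longleftrightarrow> lie_algebra hbr \<and> lie_algebra ebr \<and>
     lie_short_exact (\<lambda>\<phi> \<psi>. 0) ebr hbr (\<lambda>\<phi>. (\<phi>, 0)) snd \<and>
     closed_two_form ebr canonical_two_form"

text \<open>HOL has no quantification over types, so the vector space underlying \<open>\<hh>\<close> is a type
  parameter; its bracket is existentially quantified. As the hypothesis of a theorem, with
  \<open>'h\<close> a type variable, this amounts to existential quantification over \<open>\<hh>\<close>.\<close>

definition symplectic_cotangent_solution ::
  "'h::real_vector itself \<Rightarrow> ('g::real_vector \<Rightarrow> 'g \<Rightarrow> 'g) \<Rightarrow> ('g \<Rightarrow> 'g \<Rightarrow> real) \<Rightarrow> bool" where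
  "symplectic_cotangent_solution _ br \<omega> \<longleftrightarrow> lie_algebra br \<and> symplectic_form br \<omega> \<and>
     (\<exists>(hbr :: 'h \<Rightarrow> 'h \<Rightarrow> 'h) ebr f. cotangent_extension hbr ebr \<and> lie_iso br ebr f \<and>
        (\<forall>x y. canonical_two_form (f x) (f y) = \<omega> x y))"

definition cotangent_solution ::
  "'h::real_vector itself \<Rightarrow> ('g::real_vector \<Rightarrow> 'g \<Rightarrow> 'g) \<Rightarrow> bool" where
  "cotangent_solution H br \<longleftrightarrow> (\<exists>\<omega>. symplectic_cotangent_solution H br \<omega>)"


section \<open>The Lie algebra of affine transformations of the complex line\<close>

text \<open>The pair \<open>(a, b)\<close> is the infinitesimal affine map \<open>z \<mapsto> az + b\<close>, and the bracket is the
  commutator of the corresponding matrices.\<close>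

definition aff_complex :: "complex \<times> complex \<Rightarrow> complex \<times> complex \<Rightarrow> complex \<times> complex" where
  "aff_complex = (\<lambda>(a, b) (c, d). (0, a * d - c * b))"

lemma lie_algebra_aff_complex: "lie_algebra aff_complex"
  unfolding lie_algebra_def bilinear_def aff_complex_def
  by (auto intro!: linearI simp: algebra_simps prod_eq_iff)

lemma aff_complex_brackets:
  defines "e1 \<equiv> (1, 0)" and "e2 \<equiv> (\<i>, 0)" and "e3 \<equiv> (0, 1)" and "e4 \<equiv> (0, \<i>)"
  shows "aff_complex e1 e2 = 0"
    and "aff_complex e1 e3 = e3" and "aff_complex e1 e4 = e4"
    and "aff_complex e2 e3 = e4" and "aff_complex e2 e4 = - e3"
    and "aff_complex e3 e4 = 0"
  by (simp_all add: aff_complex_def assms prod_eq_iff)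

end

theory Submission
  imports Defs
begin

text \<open>
  Let \<open>\<gg> = \<hh>* \<oplus> \<hh>\<close> be a cotangent extension with \<open>dim \<gg> = 4\<close>, so \<open>dim \<hh> = 2\<close>. The quotient
  \<open>\<hh>\<close> is solvable and the ideal \<open>\<hh>*\<close> is abelian, so \<open>\<gg>\<close> is solvable. What has to be understood
  is when some \<open>ad X\<close> has a non-real eigenvalue \<open>a + \<i>b\<close>; the claim is that then
  \<open>\<gg> \<cong> \<aa>\<ff>\<ff>(\<complex>)\<close>.

  Let \<open>w\<close> be the image of \<open>X\<close> in \<open>\<hh>\<close>. In a two-dimensional Lie algebra, \<open>ad w\<close> has only
  the real eigenvalues \<open>0\<close> and its trace, hence the eigenvector lies in the complexification of
  \<open>\<hh>*\<close>, say \<open>u + \<i>v\<close> with \<open>u, v \<in> \<hh>*\<close>. Multiplying it by a complex number achieves \<open>u(w) = 1\<close>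
  and \<open>v(w) = 0\<close>, and then \<open>w\<close> can be completed to the basis \<open>w, y\<close> of \<open>\<hh>\<close> dual to \<open>u, v\<close>
  (\<open>nonreal_eigenvalue_normal_form\<close>).

  The action \<open>x \<cdot> \<phi>\<close> of \<open>\<hh>\<close> on \<open>\<hh>*\<close> is dual to a connection on \<open>\<hh>\<close>: the Jacobi identity says
  that it is flat (\<open>act_hbr\<close>), and closedness of the canonical form that it is torsion free
  (\<open>torsion_free\<close>). In the normal form these two conditions are polynomial equations in the four
  matrix entries of the action of \<open>y\<close>, and they have a single solution: \<open>[w, y] = 0\<close> in \<open>\<hh>\<close>, and
  \<open>y\<close> acts as \<open>\<i>\<close> times \<open>w\<close> for the complex structure on \<open>\<hh>*\<close> in which \<open>\<i>u = - v\<close>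
  (\<open>flat_torsion_free_complex_action\<close>). So \<open>\<hh>\<close> acts on \<open>\<hh>* \<cong> \<complex>\<close> by all complex
  multiplications. Some \<open>e \<in> \<hh>\<close> acts as the identity; this makes the extension split, because
  a bracket \<open>[e, j] = n \<in> \<hh>*\<close> is removed by replacing \<open>j\<close> with \<open>j - n\<close>. The result is
  \<open>\<complex> \<ltimes> \<complex> = \<aa>\<ff>\<ff>(\<complex>)\<close> (\<open>nonreal_eigenvalue_imp_aff_complex\<close>).
\<close>

section \<open>Linear algebra\<close>

lemma dim_UNIV_linear_bij:
  fixes f :: "'a::real_vector \<Rightarrow> 'b::real_vector"
  assumes "linear f" "bij f"
  shows "dim (UNIV :: 'b set) = dim (UNIV :: 'a set)"
proof -
  obtain B :: "'a set" where B: "independent B" "UNIV \<subseteq> span B" "card B = dim (UNIV::'a set)"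
    using basis_exists by (metis top_greatest)
  have inj: "inj f" and surj: "surj f"
    using assms(2) by (auto simp: bij_def)
  have "independent (f ` B)"
    using linear_independent_injective_image[OF assms(1) B(1)] inj by (simp add: inj_on_subset)
  moreover have "span B = UNIV" using B(2) by auto
  then have "span (f ` B) = UNIV"
    using linear_span_image[OF assms(1), of B] surj by simp
  ultimately have "dim (UNIV :: 'b set) = card (f ` B)"
    by (metis dim_eq_card span_UNIV)
  also have "\<dots> = card B"
    using inj by (meson card_image inj_on_subset top_greatest)
  finally show ?thesis using B(3) by simp
qed

text \<open>A functional that vanishes on \<open>S - {s}\<close> vanishes on its span, which therefore does not
  contain \<open>s\<close>.\<close>

lemma independent_if_coordinate_functionals:
  assumes "\<And>s. s \<in> S \<Longrightarrow> linear (c s :: 'a::real_vector \<Rightarrow> real)"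
    and "\<And>s. s \<in> S \<Longrightarrow> c s s \<noteq> 0"
    and "\<And>s t. s \<in> S \<Longrightarrow> t \<in> S \<Longrightarrow> t \<noteq> s \<Longrightarrow> c s t = 0"
  shows "independent S"
proof
  assume "dependent S"
  then obtain s where s: "s \<in> S" "s \<in> span (S - {s})"
    unfolding dependent_def by blast
  have "c s s = 0"
    using s assms(3) by (intro linear_eq_0_on_span[OF assms(1)[OF s(1)] _ s(2)]) auto
  then show False using assms(2)[OF s(1)] by simp
qed

lemma linear_dual_apply: "linear (dual_apply \<phi>)"
  using dual_apply[of \<phi>] by simp

lemma dual_eqI: "(\<And>x. dual_apply \<phi> x = dual_apply \<psi> x) \<Longrightarrow> \<phi> = \<psi>"
  by (simp add: dual_apply_inject[symmetric] fun_eq_iff)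

lemmas dual_apply_vector_simps [simp] =
  zero_dual.rep_eq plus_dual.rep_eq minus_dual.rep_eq uminus_dual.rep_eq scaleR_dual.rep_eq
  linear_0[OF linear_dual_apply] linear_add[OF linear_dual_apply]
  linear_diff[OF linear_dual_apply] linear_neg[OF linear_dual_apply]
  linear_scale[OF linear_dual_apply]

lemma dual_apply_sum: "dual_apply (\<Sum>b\<in>B. f b) x = (\<Sum>b\<in>B. dual_apply (f b) x)"
  by (induction B rule: infinite_finite_induct) auto

text \<open>A basis \<open>B\<close> of \<open>\<hh>\<close> together with its dual basis is a basis of \<open>\<hh>* \<oplus> \<hh>\<close>. Finiteness is
  demanded of \<open>\<hh>* \<oplus> \<hh>\<close> because that is the space known to be finite-dimensional in the
  application; \<open>B\<close> inherits it.\<close>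

lemma dim_dual_times:
  fixes T :: "('h::real_vector dual \<times> 'h) set"
  assumes "finite T" "span T = UNIV"
  shows "dim (UNIV :: ('h dual \<times> 'h) set) = 2 * dim (UNIV :: 'h set)"
proof -
  obtain B :: "'h set" where B: "independent B" "UNIV \<subseteq> span B" "card B = dim (UNIV::'h set)"
    using basis_exists by (metis top_greatest)
  have spanB: "\<And>x. x \<in> span B" using B(2) by auto
  have "finite B"
  proof -
    have "span (snd ` T) = UNIV"
      using linear_span_image[OF linear_snd, of T] assms(2) by simp
    then show ?thesis
      using independent_span_bound[of "snd ` T" B] assms(1) B(1) by simp
  qed
  define \<delta> where "\<delta> b = Dual (\<lambda>k. representation B k b)" for b
  have \<delta>: "dual_apply (\<delta> b) k = representation B k b" for b k
    unfolding \<delta>_def using B(1) spanB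
    by (subst Dual_inverse) (auto intro!: linearI simp: representation_add representation_scale)
  have \<delta>_basis: "dual_apply (\<delta> b) c = (if b = c then 1 else 0)" if "c \<in> B" for b c
    using representation_basis[OF B(1) that] by (simp add: \<delta>)
  have inj_\<delta>: "inj_on \<delta> B"
    by (rule inj_onI) (metis \<delta>_basis zero_neq_one)
  define S1 where "S1 = (\<lambda>b. (\<delta> b, 0 :: 'h)) ` B"
  define S2 where "S2 = (\<lambda>b. (0 :: 'h dual, b)) ` B"
  have "independent (S1 \<union> S2)"
  proof (rule independent_if_coordinate_functionals)
    (* the coordinate of (delta b, 0) is evaluation at b, that of (0, b) is delta b *)
    define c where "c s = (if s \<in> S1 then (\<lambda>t. dual_apply (fst t) (THE b. b \<in> B \<and> s = (\<delta> b, 0)))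
       else (\<lambda>t. dual_apply (\<delta> (snd s)) (snd t)))" for s :: "'h dual \<times> 'h"
    have the: "(THE b'. b' \<in> B \<and> (\<delta> b, 0) = (\<delta> b', 0 :: 'h)) = b" if "b \<in> B" for b
      using that inj_\<delta> by (intro the_equality) (auto dest: inj_onD)
    have c1: "c (\<delta> b, 0) = (\<lambda>t. dual_apply (fst t) b)" if "b \<in> B" for b
      using that the[OF that] by (auto simp: c_def S1_def)
    have "0 \<notin> B" using B(1) dependent_zero by blast
    then have c2: "c (0, b) = (\<lambda>t. dual_apply (\<delta> b) (snd t))" if "b \<in> B" for b
      using that by (auto simp: c_def S1_def)
    show "linear (c s)" for s
      unfolding c_def by (auto intro!: linearI)
    show "c s s \<noteq> 0" if "s \<in> S1 \<union> S2" for s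
      using that by (auto simp: S1_def S2_def c1 c2 \<delta>_basis)
    show "c s t = 0" if "s \<in> S1 \<union> S2" "t \<in> S1 \<union> S2" "t \<noteq> s" for s t
      using that by (auto simp: S1_def S2_def c1 c2 \<delta>_basis split: if_splits)
  qed
  moreover have "(\<phi>, k) \<in> span (S1 \<union> S2)" for \<phi> k
  proof -
    have k: "(\<Sum>b\<in>B. representation B k b *\<^sub>R b) = k" for k
      by (rule sum_representation_eq[OF B(1) spanB \<open>finite B\<close> order_refl])
    have "\<phi> = (\<Sum>b\<in>B. dual_apply \<phi> b *\<^sub>R \<delta> b)"
    proof (rule dual_eqI)
      fix x
      have "dual_apply \<phi> x = dual_apply \<phi> (\<Sum>b\<in>B. representation B x b *\<^sub>R b)"
        by (simp only: k)
      also have "\<dots> = (\<Sum>b\<in>B. representation B x b * dual_apply \<phi> b)"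
        by (simp add: linear_sum[OF linear_dual_apply])
      also have "\<dots> = dual_apply (\<Sum>b\<in>B. dual_apply \<phi> b *\<^sub>R \<delta> b) x"
        by (simp add: dual_apply_sum \<delta> mult.commute)
      finally show "dual_apply \<phi> x = dual_apply (\<Sum>b\<in>B. dual_apply \<phi> b *\<^sub>R \<delta> b) x" .
    qed
    then have "(\<phi>, k) = (\<Sum>b\<in>B. dual_apply \<phi> b *\<^sub>R (\<delta> b, 0)) + (\<Sum>b\<in>B. representation B k b *\<^sub>R (0, b))"
      using k[of k] by (simp add: prod_eq_iff fst_sum snd_sum)
    also have "\<dots> \<in> span (S1 \<union> S2)"
      by (intro span_add span_sum span_scale span_base) (auto simp: S1_def S2_def)
    finally show ?thesis .
  qed
  then have "span (S1 \<union> S2) = UNIV" by auto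
  ultimately have "dim (UNIV :: ('h dual \<times> 'h) set) = card (S1 \<union> S2)"
    by (metis dim_eq_card span_UNIV)
  also have "\<dots> = card S1 + card S2"
  proof (rule card_Un_disjoint)
    have "0 \<notin> B" using B(1) dependent_zero by blast
    then show "S1 \<inter> S2 = {}" by (auto simp: S1_def S2_def)
  qed (use \<open>finite B\<close> in \<open>auto simp: S1_def S2_def\<close>)
  also have "card S1 = card B"
    unfolding S1_def using inj_\<delta> by (intro card_image) (auto simp: inj_on_def)
  also have "card S2 = card B"
    unfolding S2_def by (intro card_image) (auto simp: inj_on_def)
  finally show ?thesis using B(3) by simp
qed

lemma dim_2_span_independent_pair:
  fixes x y :: "'a::real_vector"
  assumes "dim (UNIV :: 'a set) = 2" "independent {x, y}" "x \<noteq> y"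
  shows "span {x, y} = UNIV"
proof -
  obtain B where B: "{x, y} \<subseteq> B" "independent B" "UNIV \<subseteq> span B"
    using maximal_independent_subset_extend[OF subset_UNIV assms(2)] by metis
  have "card B = 2"
    using assms(1) B(2,3) by (metis dim_eq_card span_UNIV top.extremum_unique)
  then have "B = {x, y}"
    using B(1) assms(3) by (metis card_2_iff card_subset_eq card.infinite zero_neq_numeral)
  then show ?thesis using B(3) by auto
qed

lemma dim_2_complete_basis:
  fixes x :: "'a::real_vector"
  assumes "dim (UNIV :: 'a set) = 2" "x \<noteq> 0"
  obtains y where "\<And>k. \<exists>s t. k = s *\<^sub>R x + t *\<^sub>R y"
    "\<And>s t. s *\<^sub>R x + t *\<^sub>R y = 0 \<Longrightarrow> s = 0 \<and> t = 0"
proof -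
  have "independent {x}" using assms(2) by simp
  then obtain B where B: "{x} \<subseteq> B" "independent B" "UNIV \<subseteq> span B"
    using maximal_independent_subset_extend[OF subset_UNIV] by metis
  have "card B = 2"
    using assms(1) B(2,3) by (metis dim_eq_card span_UNIV top.extremum_unique)
  then obtain y where y: "B = {x, y}" "x \<noteq> y"
    using B(1) by (auto simp: card_2_iff)
  show ?thesis
  proof
    show "\<exists>s t. k = s *\<^sub>R x + t *\<^sub>R y" for k
    proof -
      have "k \<in> span {x, y}" using B(3) y(1) by auto
      then obtain s t where "k - s *\<^sub>R x = t *\<^sub>R y"
        unfolding span_breakdown_eq span_singleton by blast
      then have "k = s *\<^sub>R x + t *\<^sub>R y" by (simp add: algebra_simps)
      then show ?thesis by blast
    qed
    show "s = 0 \<and> t = 0" if "s *\<^sub>R x + t *\<^sub>R y = 0" for s t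
    proof (cases "t = 0")
      case True
      then show ?thesis using that assms(2) by simp
    next
      case False
      have "t *\<^sub>R y = (- s) *\<^sub>R x"
        using that by (simp add: eq_neg_iff_add_eq_0 add.commute)
      then have "inverse t *\<^sub>R (t *\<^sub>R y) = inverse t *\<^sub>R ((- s) *\<^sub>R x)" by (rule arg_cong)
      then have "y = (inverse t * - s) *\<^sub>R x"
        using False by simp
      then have "y \<in> span {x}" by (metis span_base span_scale singletonI)
      moreover have "B - {y} = {x}" "y \<in> B" using y by auto
      ultimately have "dependent B" unfolding dependent_def by metis
      then show ?thesis using B(2) by blast
    qed
  qed
qed

text \<open>The equations say \<open>(a + \<i>b) (x + \<i>y) = 0\<close> in the complexification; multiplying by the
  conjugate of the scalar gives \<open>(a\<^sup>2 + b\<^sup>2) x = 0\<close>.\<close>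

lemma rotation_kernel_trivial:
  fixes x y :: "'a::real_vector"
  assumes "b \<noteq> 0" "a *\<^sub>R x = b *\<^sub>R y" "a *\<^sub>R y = - (b *\<^sub>R x)"
  shows "x = 0 \<and> y = 0"
proof -
  have "(a * a) *\<^sub>R x = b *\<^sub>R (a *\<^sub>R y)"
    using arg_cong[OF assms(2), of "\<lambda>v. a *\<^sub>R v"] by (simp add: mult.commute)
  then have "(a * a + b * b) *\<^sub>R x = 0"
    by (simp add: assms(3) scaleR_add_left)
  moreover have "a * a + b * b \<noteq> 0"
    using assms(1) sum_squares_eq_zero_iff by blast
  ultimately have "x = 0" using scaleR_eq_0_iff by blast
  with assms(1,2) show ?thesis by simp
qed

lemma inverse_norm_square_scale:
  fixes x :: "'a::real_vector"
  assumes "r = a\<^sup>2 + b\<^sup>2" "r \<noteq> 0"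
  shows "(1 / r) *\<^sub>R ((a * a) *\<^sub>R x + (b * b) *\<^sub>R x) = x"
proof -
  have "(a * a) *\<^sub>R x + (b * b) *\<^sub>R x = r *\<^sub>R x"
    by (simp add: assms(1) power2_eq_square scaleR_add_left)
  then show ?thesis using assms(2) by simp
qed

section \<open>Lie algebras\<close>

lemma lie_algebra_simps:
  assumes "lie_algebra br"
  shows "br (x + y) z = br x z + br y z" "br x (y + z) = br x y + br x z"
    "br (x - y) z = br x z - br y z" "br x (y - z) = br x y - br x z"
    "br (c *\<^sub>R x) y = c *\<^sub>R br x y" "br x (c *\<^sub>R y) = c *\<^sub>R br x y"
    "br (- x) y = - br x y" "br x (- y) = - br x y"
    "br 0 x = 0" "br x 0 = 0" "br x x = 0"
proof -
  have b: "bilinear br"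
    using assms unfolding lie_algebra_def by auto
  show "br x x = 0"
    using assms unfolding lie_algebra_def by auto
  note rules = bilinear_ladd[OF b] bilinear_radd[OF b] bilinear_lsub[OF b] bilinear_rsub[OF b]
    bilinear_lmul[OF b] bilinear_rmul[OF b] bilinear_lneg[OF b] bilinear_rneg[OF b]
    bilinear_lzero[OF b] bilinear_rzero[OF b]
  show "br (x + y) z = br x z + br y z" "br x (y + z) = br x y + br x z"
    "br (x - y) z = br x z - br y z" "br x (y - z) = br x y - br x z"
    "br (c *\<^sub>R x) y = c *\<^sub>R br x y" "br x (c *\<^sub>R y) = c *\<^sub>R br x y"
    "br (- x) y = - br x y" "br x (- y) = - br x y" "br 0 x = 0" "br x 0 = 0"
    by (rule rules)+
qed

lemma lie_algebra_anticommute: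
  assumes "lie_algebra br"
  shows "br y x = - br x y"
proof -
  have "br x x + br y x + (br x y + br y y) = 0"
    using lie_algebra_simps(11)[OF assms, of "x + y"] unfolding lie_algebra_simps(1,2)[OF assms] .
  then show ?thesis
    by (simp add: lie_algebra_simps(11)[OF assms] eq_neg_iff_add_eq_0 add.commute)
qed

lemma lie_algebra_jacobi:
  assumes "lie_algebra br"
  shows "br (br x y) z = br x (br y z) - br y (br x z)"
proof -
  have "br x (br y z) + br y (br z x) + br z (br x y) = 0"
    using assms by (simp add: lie_algebra_def)
  moreover have "br y (br z x) = - br y (br x z)"
    using lie_algebra_anticommute[OF assms, of z x] by (simp add: lie_algebra_simps[OF assms])
  ultimately show ?thesis
    using lie_algebra_anticommute[OF assms, of "br x y" z] by (simp add: algebra_simps)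
qed

lemma derived_series_lie_hom:
  assumes "lie_hom br br' p"
  shows "p ` derived_series br n \<subseteq> derived_series br' n"
proof (induction n)
  case (Suc n)
  have lin: "linear p" and hom: "\<And>x y. p (br x y) = br' (p x) (p y)"
    using assms by (auto simp: lie_hom_def)
  show ?case
    unfolding derived_series.simps linear_span_image[OF lin, symmetric]
  proof (rule span_mono, safe)
    fix x y assume "x \<in> derived_series br n" "y \<in> derived_series br n"
    then have "p x \<in> derived_series br' n" "p y \<in> derived_series br' n" using Suc by auto
    then show "\<exists>x' y'. p (br x y) = br' x' y' \<and> x' \<in> derived_series br' n \<and> y' \<in> derived_series br' n"
      using hom by blast
  qed
qed auto

text \<open>The derived series reaches the kernel when its image reaches \<open>0\<close>, and one more step kills
  the kernel.\<close>

lemma solvable_extension_abelian_kernel: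
  assumes "lie_algebra br" "lie_hom br br' p" "solvable_lie br'"
    and abelian: "\<And>x y. p x = 0 \<Longrightarrow> p y = 0 \<Longrightarrow> br x y = 0"
  shows "solvable_lie br"
proof -
  obtain n where "derived_series br' n = {0}"
    using assms(3) by (auto simp: solvable_lie_def)
  then have "p x = 0" if "x \<in> derived_series br n" for x
    using derived_series_lie_hom[OF assms(2), of n] that by auto
  then have "{br x y | x y. x \<in> derived_series br n \<and> y \<in> derived_series br n} \<subseteq> {0}"
    using abelian by auto
  then have "derived_series br (Suc n) \<subseteq> {0}"
    unfolding derived_series.simps by (rule span_minimal) (rule subspace_single_0)
  moreover have "0 \<in> derived_series br (Suc n)" by (simp add: span_zero)
  ultimately show ?thesis
    using assms(1) unfolding solvable_lie_def by blast
qed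

text \<open>All brackets are multiples of the bracket of the two basis vectors, so the derived algebra is at
  most one-dimensional and hence abelian.\<close>

lemma solvable_dim_2:
  fixes br :: "'a::real_vector \<Rightarrow> 'a \<Rightarrow> 'a"
  assumes lie: "lie_algebra br" and dim: "dim (UNIV :: 'a set) = 2"
  shows "solvable_lie br"
proof -
  note simps = lie_algebra_simps[OF lie]
  have "\<exists>x :: 'a. x \<noteq> 0"
  proof (rule ccontr)
    assume "\<not> ?thesis"
    then have "UNIV = {0 :: 'a}" by auto
    then have "dim (UNIV :: 'a set) = dim {0 :: 'a}" by simp
    then show False using dim dim_eq_card[of "{}" "{0 :: 'a}"] independent_empty by simp
  qed
  then obtain x :: 'a where "x \<noteq> 0" by blast
  then obtain y where y: "\<And>k. \<exists>s t. k = s *\<^sub>R x + t *\<^sub>R y"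
    using dim_2_complete_basis[OF dim] by metis
  have "br k l \<in> span {br x y}" for k l
  proof -
    obtain s t s' t' where "k = s *\<^sub>R x + t *\<^sub>R y" "l = s' *\<^sub>R x + t' *\<^sub>R y"
      using y by meson
    then have "br k l = (s * t' - t * s') *\<^sub>R br x y"
      using lie_algebra_anticommute[OF lie, of x y] by (simp add: simps algebra_simps)
    then show ?thesis by (simp add: span_base span_scale)
  qed
  then have "derived_series br 1 \<subseteq> span {br x y}"
    unfolding One_nat_def derived_series.simps by (intro span_minimal) auto
  then have "br k l = 0" if "k \<in> derived_series br 1" "l \<in> derived_series br 1" for k l
  proof -
    have "k \<in> range (\<lambda>c. c *\<^sub>R br x y)" "l \<in> range (\<lambda>c. c *\<^sub>R br x y)"
      using that \<open>derived_series br 1 \<subseteq> span {br x y}\<close> unfolding span_singleton by blast+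
    then show ?thesis by (auto simp: simps)
  qed
  then have "{br k l | k l. k \<in> derived_series br 1 \<and> l \<in> derived_series br 1} \<subseteq> {0}"
    by blast
  then have "span {br k l | k l. k \<in> derived_series br 1 \<and> l \<in> derived_series br 1} \<subseteq> {0}"
    by (rule span_minimal) (rule subspace_single_0)
  then have "derived_series br (Suc 1) \<subseteq> {0}"
    unfolding derived_series.simps(2)[of br 1] .
  moreover have "0 \<in> derived_series br (Suc 1)" by (simp add: span_zero)
  ultimately show ?thesis
    using lie unfolding solvable_lie_def by blast
qed

text \<open>For \<open>w \<noteq> 0\<close> and a basis \<open>w, y\<close>, the matrix of \<open>ad w\<close> is triangular, because \<open>[w, w] = 0\<close>; so
  its eigenvalues are real. The hypotheses say that \<open>h1 + \<i>h2\<close> satisfies the eigenvector equation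
  for \<open>a + \<i>b\<close>.\<close>

lemma no_nonreal_ad_eigenvector_dim_2:
  fixes br :: "'a::real_vector \<Rightarrow> 'a \<Rightarrow> 'a"
  assumes lie: "lie_algebra br" and dim: "dim (UNIV :: 'a set) = 2" and "b \<noteq> 0"
    and h1: "br w h1 = a *\<^sub>R h1 - b *\<^sub>R h2" and h2: "br w h2 = a *\<^sub>R h2 + b *\<^sub>R h1"
  shows "h1 = 0 \<and> h2 = 0"
proof -
  note simps = lie_algebra_simps[OF lie]
  show ?thesis
  proof (cases "w = 0")
    case True
    then show ?thesis
      using h1 h2 by (intro rotation_kernel_trivial[OF \<open>b \<noteq> 0\<close>]) (auto simp: simps add_eq_0_iff)
  next
    case False
    then obtain y where y: "\<And>k. \<exists>s t. k = s *\<^sub>R w + t *\<^sub>R y"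
      and ind: "\<And>s t. s *\<^sub>R w + t *\<^sub>R y = 0 \<Longrightarrow> s = 0 \<and> t = 0"
      using dim_2_complete_basis[OF dim] by metis
    obtain c1 c2 s1 t1 s2 t2 where c: "br w y = c1 *\<^sub>R w + c2 *\<^sub>R y"
      and k1: "h1 = s1 *\<^sub>R w + t1 *\<^sub>R y" and k2: "h2 = s2 *\<^sub>R w + t2 *\<^sub>R y"
      using y by meson
    have "(t1 * c1 - (a * s1 - b * s2)) *\<^sub>R w + (t1 * c2 - (a * t1 - b * t2)) *\<^sub>R y = 0"
      using h1 unfolding k1 k2 by (simp add: simps c algebra_simps)
    from ind[OF this] have e1: "t1 * c1 = a * s1 - b * s2" "t1 * c2 = a * t1 - b * t2" by auto
    have "(t2 * c1 - (a * s2 + b * s1)) *\<^sub>R w + (t2 * c2 - (a * t2 + b * t1)) *\<^sub>R y = 0"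
      using h2 unfolding k1 k2 by (simp add: simps c algebra_simps)
    from ind[OF this] have e2: "t2 * c1 = a * s2 + b * s1" "t2 * c2 = a * t2 + b * t1" by auto
    (* c2 is the diagonal entry of ad w at y, and 0 the one at w *)
    have "t1 = 0 \<and> t2 = 0"
      by (rule rotation_kernel_trivial[OF \<open>b \<noteq> 0\<close>, of "a - c2"]) (use e1 e2 in \<open>auto simp: algebra_simps\<close>)
    moreover from this have "s1 = 0 \<and> s2 = 0"
      by (intro rotation_kernel_trivial[OF \<open>b \<noteq> 0\<close>, of a]) (use e1 e2 in \<open>auto simp: algebra_simps\<close>)
    ultimately show ?thesis using k1 k2 by simp
  qed
qed

lemma lie_isomorphic_trans:
  assumes "lie_isomorphic br br'" "lie_isomorphic br' br''"
  shows "lie_isomorphic br br''"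
proof -
  obtain f g where "lie_iso br br' f" "lie_iso br' br'' g"
    using assms unfolding lie_isomorphic_def by blast
  then have "lie_iso br br'' (g \<circ> f)"
    unfolding lie_iso_def lie_hom_def by (auto intro: linear_compose bij_comp)
  then show ?thesis unfolding lie_isomorphic_def by blast
qed

lemma lie_isomorphic_sym:
  assumes "lie_isomorphic br br'"
  shows "lie_isomorphic br' br"
proof -
  obtain f where lin: "linear f" and hom: "\<And>x y. f (br x y) = br' (f x) (f y)" and bij: "bij f"
    using assms unfolding lie_isomorphic_def lie_iso_def lie_hom_def by blast
  have inv: "inv f (f x) = x" "f (inv f y) = y" for x y
    using bij by (auto simp: bij_is_inj bij_is_surj surj_f_inv_f)
  have "linear (inv f)"
  proof (rule linearI)
    show "inv f (x + y) = inv f x + inv f y" for x y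
      using inv(1)[of "inv f x + inv f y"] by (simp add: linear_add[OF lin] inv)
    show "inv f (c *\<^sub>R x) = c *\<^sub>R inv f x" for c x
      using inv(1)[of "c *\<^sub>R inv f x"] by (simp add: linear_scale[OF lin] inv)
  qed
  moreover have "inv f (br' x y) = br (inv f x) (inv f y)" for x y
    using inv(1)[of "br (inv f x) (inv f y)"] by (simp add: hom inv)
  ultimately show ?thesis
    using bij_imp_bij_inv[OF bij] unfolding lie_isomorphic_def lie_iso_def lie_hom_def by blast
qed

lemma lie_isomorphic_aff_complexI:
  assumes lie: "lie_algebra br"
    and br: "br E J = 0" "br E U = U" "br E V = V" "br J U = V" "br J V = - U" "br U V = 0"
    and span: "\<And>k. \<exists>p q r s. k = p *\<^sub>R E + q *\<^sub>R J + r *\<^sub>R U + s *\<^sub>R V"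
    and ind: "\<And>p q r s. p *\<^sub>R E + q *\<^sub>R J + r *\<^sub>R U + s *\<^sub>R V = 0
      \<Longrightarrow> p = 0 \<and> q = 0 \<and> r = 0 \<and> s = 0"
  shows "lie_isomorphic br aff_complex"
proof (rule lie_isomorphic_sym)
  define F where "F = (\<lambda>(z1, z2). Re z1 *\<^sub>R E + Im z1 *\<^sub>R J + Re z2 *\<^sub>R U + Im z2 *\<^sub>R V)"
  have lin: "linear F"
    by (rule linearI) (auto simp: F_def algebra_simps)
  have "F (aff_complex x y) = br (F x) (F y)" for x y
  proof -
    note anti = lie_algebra_anticommute[OF lie]
    have br': "br J E = 0" "br U E = - U" "br V E = - V" "br U J = - V" "br V J = U" "br V U = 0"
      using anti[of J E] anti[of U E] anti[of V E] anti[of U J] anti[of V J] anti[of V U]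
      unfolding br minus_minus minus_zero .
    show ?thesis
      by (cases x; cases y)
        (simp add: F_def aff_complex_def lie_algebra_simps[OF lie] br br' algebra_simps)
  qed
  moreover have "inj F"
    unfolding linear_injective_0[OF lin] using ind by (auto simp: F_def prod_eq_iff complex_eq_iff)
  moreover have "surj F"
  proof
    show "UNIV \<subseteq> range F"
    proof
      fix k
      obtain p q r s where "k = p *\<^sub>R E + q *\<^sub>R J + r *\<^sub>R U + s *\<^sub>R V" using span by meson
      then have "k = F (Complex p q, Complex r s)" by (simp add: F_def)
      then show "k \<in> range F" by blast
    qed
  qed auto
  ultimately show "lie_isomorphic aff_complex br"
    using lin unfolding lie_isomorphic_def lie_iso_def lie_hom_def bij_def by blast
qed

section \<open>Cotangent extensions of two-dimensional Lie algebras\<close>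

text \<open>
  The setting is a basis \<open>w, y\<close> of \<open>\<hh>\<close> with dual basis \<open>u, v\<close>, where \<open>w \<cdot> u = a u - b v\<close>,
  \<open>w \<cdot> v = a v + b u\<close>, \<open>y \<cdot> u = b11 u + b12 v\<close> and \<open>y \<cdot> v = b21 u + b22 v\<close>. Torsion freeness gives
  \<open>[w, y] = c1 w + c2 y\<close> with the \<open>c1\<close>, \<open>c2\<close> below, and the four equations express
  \<open>w \<cdot> (y \<cdot> \<phi>) - y \<cdot> (w \<cdot> \<phi>) = [w, y] \<cdot> \<phi>\<close> for \<open>\<phi> = u\<close> and \<open>\<phi> = v\<close>, component by component.

  Up to the factor \<open>b\<close>, the commutator sees only the part \<open>(b12 + b21, b22 - b11)\<close> of the matrix of
  \<open>y\<close> that anticommutes with the complex structure. On this plane the equations say that \<open>2 b\<close>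
  times one coordinate is \<open>\<mp> c2\<close> times the other, which forces both to vanish; so \<open>y\<close> acts
  complex linearly. What remains is \<open>(a, b) c1 + (b11, b21) c2 = 0\<close>, which leads to \<open>c1 = c2 = 0\<close>.
\<close>

lemma flat_torsion_free_complex_action:
  fixes a b b11 b12 b21 b22 :: real
  defines "c1 \<equiv> b11 + b" and "c2 \<equiv> b21 - a"
  assumes "b \<noteq> 0"
    and e1: "b * (b12 + b21) = c1 * a + c2 * b11"
    and e2: "b * (b22 - b11) = - c1 * b + c2 * b12"
    and e3: "b * (b22 - b11) = c1 * b + c2 * b21"
    and e4: "- b * (b12 + b21) = c1 * a + c2 * b22"
  shows "c1 = 0" "c2 = 0" "b11 = - b" "b21 = a" "b12 = - a" "b22 = - b"
proof -
  have PQ: "2 * b * (b12 + b21) = - c2 * (b22 - b11)" "2 * b * (b22 - b11) = c2 * (b12 + b21)"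
    using e1 e2 e3 e4 by (simp_all add: algebra_simps)
  have "((2 * b)\<^sup>2 + c2\<^sup>2) * (b12 + b21) = 0"
    using PQ by algebra
  moreover have "(2 * b)\<^sup>2 + c2\<^sup>2 \<noteq> 0"
    using \<open>b \<noteq> 0\<close> unfolding sum_power2_eq_zero_iff by simp
  ultimately have P: "b12 + b21 = 0" by simp
  then have Q: "b22 - b11 = 0"
    using PQ(2) \<open>b \<noteq> 0\<close> by simp
  have "c1 * a + c2 * b11 = 0" "c1 * b + c2 * b21 = 0"
    using e1 e3 unfolding P Q by simp_all
  then have "b * (c1\<^sup>2 + c2\<^sup>2) = 0"
    unfolding c1_def c2_def by algebra
  then have c: "c1 = 0 \<and> c2 = 0"
    using \<open>b \<noteq> 0\<close> by (simp add: sum_power2_eq_zero_iff)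
  then show "c1 = 0" "c2 = 0" by auto
  with P Q show "b11 = - b" "b21 = a" "b12 = - a" "b22 = - b"
    by (auto simp: c1_def c2_def)
qed

locale cotangent_ext =
  fixes hbr :: "'h::real_vector \<Rightarrow> 'h \<Rightarrow> 'h"
    and ebr :: "'h dual \<times> 'h \<Rightarrow> 'h dual \<times> 'h \<Rightarrow> 'h dual \<times> 'h"
  assumes ext: "cotangent_extension hbr ebr"
begin

lemma lie_h: "lie_algebra hbr" and lie_e: "lie_algebra ebr"
  and snd_hom: "lie_hom ebr hbr snd"
  using ext by (auto simp: cotangent_extension_def lie_short_exact_def)

lemmas h_simps = lie_algebra_simps[OF lie_h]
lemmas e_simps = lie_algebra_simps[OF lie_e]

lemma snd_ebr [simp]: "snd (ebr X Y) = hbr (snd X) (snd Y)"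
  using snd_hom by (auto simp only: lie_hom_def)

lemma dual_abelian: "ebr (\<phi>, 0) (\<psi>, 0) = 0"
proof -
  have "lie_hom (\<lambda>\<phi> \<psi>. 0) ebr (\<lambda>\<phi>. (\<phi>, 0 :: 'h))"
    using ext by (auto simp: cotangent_extension_def lie_short_exact_def)
  then show ?thesis by (metis lie_hom_def linear_0)
qed

definition act :: "'h \<Rightarrow> 'h dual \<Rightarrow> 'h dual" where
  "act x \<phi> = fst (ebr (0, x) (\<phi>, 0))"

lemma ebr_dual: "ebr (\<phi>, x) (\<psi>, 0) = (act x \<psi>, 0)"
proof -
  have "ebr (\<phi>, x) (\<psi>, 0) = ebr ((\<phi>, 0) + (0, x)) (\<psi>, 0)" by simp
  also have "\<dots> = ebr (0, x) (\<psi>, 0)" unfolding e_simps(1) by (simp add: dual_abelian)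
  finally show ?thesis by (simp add: prod_eq_iff act_def h_simps)
qed

lemma act_simps:
  "act (x + y) \<phi> = act x \<phi> + act y \<phi>" "act (x - y) \<phi> = act x \<phi> - act y \<phi>"
  "act (c *\<^sub>R x) \<phi> = c *\<^sub>R act x \<phi>" "act 0 \<phi> = 0"
  "act x (\<phi> + \<psi>) = act x \<phi> + act x \<psi>" "act x (\<phi> - \<psi>) = act x \<phi> - act x \<psi>"
  "act x (c *\<^sub>R \<phi>) = c *\<^sub>R act x \<phi>" "act x (- \<phi>) = - act x \<phi>" "act x 0 = 0"
proof -
  have pair: "(0, x + y) = (0 :: 'h dual, x) + (0, y)" "(0, x - y) = (0 :: 'h dual, x) - (0, y)"
    "(0, c *\<^sub>R x) = c *\<^sub>R (0 :: 'h dual, x)" "(\<phi> + \<psi>, 0) = (\<phi>, 0 :: 'h) + (\<psi>, 0)"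
    "(\<phi> - \<psi>, 0) = (\<phi>, 0 :: 'h) - (\<psi>, 0)" "(c *\<^sub>R \<phi>, 0) = c *\<^sub>R (\<phi>, 0 :: 'h)"
    "(- \<phi>, 0) = - (\<phi>, 0 :: 'h)" "(0 :: 'h dual, 0 :: 'h) = 0"
    by (simp_all add: prod_eq_iff)
  show "act (x + y) \<phi> = act x \<phi> + act y \<phi>" "act (x - y) \<phi> = act x \<phi> - act y \<phi>"
    "act (c *\<^sub>R x) \<phi> = c *\<^sub>R act x \<phi>" "act 0 \<phi> = 0"
    "act x (\<phi> + \<psi>) = act x \<phi> + act x \<psi>" "act x (\<phi> - \<psi>) = act x \<phi> - act x \<psi>"
    "act x (c *\<^sub>R \<phi>) = c *\<^sub>R act x \<phi>" "act x (- \<phi>) = - act x \<phi>" "act x 0 = 0"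
    unfolding act_def pair e_simps by simp_all
qed

text \<open>Flatness. The action is that of a lift of \<open>x\<close> to the extension, and since \<open>\<hh>*\<close> is abelian it
  does not depend on the lift (\<open>ebr_dual\<close>); so the \<open>\<hh>*\<close>-part of the bracket of two lifts, the
  cocycle of the extension, drops out.\<close>

lemma act_hbr: "act (hbr x y) \<phi> = act x (act y \<phi>) - act y (act x \<phi>)"
proof -
  have "ebr (0, x) (0, y) = (fst (ebr (0, x) (0, y)), hbr x y)"
    by (simp add: prod_eq_iff)
  then have "(act (hbr x y) \<phi>, 0) = ebr (ebr (0, x) (0, y)) (\<phi>, 0)"
    by (metis ebr_dual)
  also have "\<dots> = (act x (act y \<phi>) - act y (act x \<phi>), 0)"
    unfolding lie_algebra_jacobi[OF lie_e] ebr_dual by simp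
  finally show ?thesis by simp
qed

text \<open>For the connection on \<open>\<hh>\<close> with \<open>\<phi> (\<nabla>\<^sub>x y) = - (x \<cdot> \<phi>) (y)\<close> this reads
  \<open>[x, y] = \<nabla>\<^sub>x y - \<nabla>\<^sub>y x\<close>.\<close>

lemma torsion_free:
  "dual_apply \<phi> (hbr x y) = dual_apply (act y \<phi>) x - dual_apply (act x \<phi>) y"
proof -
  have "ce_diff ebr canonical_two_form (0, x) (0, y) (\<phi>, 0) = 0"
    using ext by (simp add: cotangent_extension_def closed_two_form_def)
  moreover have "ebr (0, x) (0, y) = (fst (ebr (0, x) (0, y)), hbr x y)"
    by (simp add: prod_eq_iff)
  ultimately show ?thesis
    by (simp add: ce_diff_def ebr_dual canonical_two_form_def case_prod_beta)
qed

lemma complex_eigenvalueE: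
  assumes "complex_eigenvalue T z"
  obtains p q where "p \<noteq> 0 \<or> q \<noteq> 0"
    "T p = Re z *\<^sub>R p - Im z *\<^sub>R q" "T q = Re z *\<^sub>R q + Im z *\<^sub>R p"
proof -
  obtain W where "W \<noteq> 0" "map_prod T T W = scaleC_complexification z W"
    using assms unfolding complex_eigenvalue_def by blast
  then show ?thesis
    by (intro that[of "fst W" "snd W"])
      (auto simp: prod_eq_iff scaleC_complexification_def)
qed

text \<open>The eigenvector \<open>p + \<i>q\<close> lies in the complexification of \<open>\<hh>*\<close>. It can be normalised
  to take the value \<open>1\<close> at \<open>w\<close> as soon as \<open>p(w)\<close> and \<open>q(w)\<close> are not both \<open>0\<close>. If they were, \<open>p\<close> and \<open>q\<close> would lie in the
  line of functionals on \<open>\<hh>\<close> that vanish at \<open>w\<close>, so the eigenvector would be a complex multiple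
  of a real vector and the eigenvalue would be real.\<close>

lemma nonreal_eigenvalue_normal_form:
  assumes dim: "dim (UNIV :: 'h set) = 2"
    and z: "complex_eigenvalue (ebr X) z" "z \<notin> \<real>"
  obtains w y u v a b where "b \<noteq> 0"
    "act w u = a *\<^sub>R u - b *\<^sub>R v" "act w v = a *\<^sub>R v + b *\<^sub>R u"
    "dual_apply u w = 1" "dual_apply v w = 0" "dual_apply u y = 0" "dual_apply v y = 1"
    "\<And>k. k = dual_apply u k *\<^sub>R w + dual_apply v k *\<^sub>R y"
    "\<And>\<phi>. \<phi> = dual_apply \<phi> w *\<^sub>R u + dual_apply \<phi> y *\<^sub>R v"
proof -
  define w where "w = snd X"
  define a where "a = Re z"
  define b where "b = Im z"
  have b: "b \<noteq> 0" using z(2) by (simp add: b_def complex_is_Real_iff)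
  obtain P Q where nz: "P \<noteq> 0 \<or> Q \<noteq> 0"
    and P: "ebr X P = a *\<^sub>R P - b *\<^sub>R Q" and Q: "ebr X Q = a *\<^sub>R Q + b *\<^sub>R P"
    using complex_eigenvalueE[OF z(1)] unfolding a_def b_def by metis
  have "snd P = 0 \<and> snd Q = 0"
  proof (rule no_nonreal_ad_eigenvector_dim_2[OF lie_h dim b])
    show "hbr w (snd P) = a *\<^sub>R snd P - b *\<^sub>R snd Q"
      using arg_cong[OF P, of snd] by (simp add: w_def)
    show "hbr w (snd Q) = a *\<^sub>R snd Q + b *\<^sub>R snd P"
      using arg_cong[OF Q, of snd] by (simp add: w_def)
  qed
  then obtain p q where PQ: "P = (p, 0)" "Q = (q, 0)"
    by (metis prod.collapse)
  have X: "X = (fst X, w)" by (simp add: w_def)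
  have p: "act w p = a *\<^sub>R p - b *\<^sub>R q" and q: "act w q = a *\<^sub>R q + b *\<^sub>R p"
    using P Q ebr_dual[of "fst X" w] X unfolding PQ by auto
  have pq: "p \<noteq> 0 \<or> q \<noteq> 0" using nz PQ by (auto simp: prod_eq_iff)
  have "w \<noteq> 0"
  proof
    assume "w = 0"
    then have "ebr X (p, 0) = 0" "ebr X (q, 0) = 0"
      using X by (metis dual_abelian)+
    then have "a *\<^sub>R p = b *\<^sub>R q" "a *\<^sub>R q = - (b *\<^sub>R p)"
      using P Q unfolding PQ by (auto simp: prod_eq_iff add_eq_0_iff)
    then show False using rotation_kernel_trivial[OF b] pq by blast
  qed
  have w_values: "dual_apply p w \<noteq> 0 \<or> dual_apply q w \<noteq> 0"
  proof (rule ccontr)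
    assume "\<not> ?thesis"
    then have 0: "dual_apply p w = 0" "dual_apply q w = 0" by auto
    obtain y where y: "\<And>k. \<exists>s t. k = s *\<^sub>R w + t *\<^sub>R y"
      using dim_2_complete_basis[OF dim \<open>w \<noteq> 0\<close>] by metis
    define s where "s = dual_apply p y"
    define t where "t = dual_apply q y"
    have eq: "t *\<^sub>R p = s *\<^sub>R q"
    proof (rule dual_eqI)
      fix k
      obtain c d where "k = c *\<^sub>R w + d *\<^sub>R y" using y by meson
      then show "dual_apply (t *\<^sub>R p) k = dual_apply (s *\<^sub>R q) k"
        by (simp add: 0 s_def t_def)
    qed
    have "t *\<^sub>R act w p = s *\<^sub>R act w q"
      using arg_cong[OF eq, of "act w"] by (simp add: act_simps)
    then have "dual_apply (t *\<^sub>R (a *\<^sub>R p - b *\<^sub>R q)) y = dual_apply (s *\<^sub>R (a *\<^sub>R q + b *\<^sub>R p)) y"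
      by (simp add: p q)
    then have "t * (a * s - b * t) = s * (a * t + b * s)"
      by (simp add: s_def t_def)
    then have "b * (s\<^sup>2 + t\<^sup>2) = 0" by algebra
    then have st: "s = 0" "t = 0" using b by (simp_all add: sum_power2_eq_zero_iff)
    have "p = 0 \<and> q = 0"
    proof (intro conjI dual_eqI)
      fix k
      obtain c d where k: "k = c *\<^sub>R w + d *\<^sub>R y" using y by meson
      show "dual_apply p k = dual_apply 0 k" "dual_apply q k = dual_apply 0 k"
        using st by (simp_all add: k 0 s_def t_def)
    qed
    then show False using pq by simp
  qed
  define s where "s = dual_apply p w"
  define t where "t = dual_apply q w"
  define n where "n = s\<^sup>2 + t\<^sup>2"
  have n: "n \<noteq> 0" using w_values by (simp add: n_def s_def t_def sum_power2_eq_zero_iff)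
  (* u + i v is p + i q divided by its value s + i t at w *)
  define u where "u = (1 / n) *\<^sub>R (s *\<^sub>R p + t *\<^sub>R q)"
  define v where "v = (1 / n) *\<^sub>R (s *\<^sub>R q - t *\<^sub>R p)"
  have uw: "dual_apply u w = 1"
    using n by (simp add: u_def flip: s_def t_def) (simp add: n_def power2_eq_square)
  have vw: "dual_apply v w = 0"
    by (simp add: v_def flip: s_def t_def)
  have act_u: "act w u = a *\<^sub>R u - b *\<^sub>R v"
    by (simp add: u_def v_def act_simps p q algebra_simps)
  have act_v: "act w v = a *\<^sub>R v + b *\<^sub>R u"
    by (simp add: u_def v_def act_simps p q algebra_simps)
  have "v \<noteq> 0"
  proof
    assume "v = 0"
    then have "b *\<^sub>R u = 0" using act_v by (simp add: act_simps)
    then show False using b uw by auto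
  qed
  then obtain k where k: "dual_apply v k \<noteq> 0"
    by (metis dual_eqI zero_dual.rep_eq)
  define y where "y = (1 / dual_apply v k) *\<^sub>R (k - dual_apply u k *\<^sub>R w)"
  have uy: "dual_apply u y = 0" and vy: "dual_apply v y = 1"
    using k by (simp_all add: y_def uw vw)
  have "independent {w, y}"
    by (rule independent_if_coordinate_functionals[where c = "\<lambda>s. if s = w then dual_apply u else dual_apply v"])
      (auto simp: uw vw uy vy linear_dual_apply)
  moreover have "w \<noteq> y" using uw uy by auto
  ultimately have "span {w, y} = UNIV" by (rule dim_2_span_independent_pair[OF dim])
  have coords: "k = dual_apply u k *\<^sub>R w + dual_apply v k *\<^sub>R y" for k
  proof -
    have "k \<in> span {w, y}" using \<open>span {w, y} = UNIV\<close> by simp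
    then obtain c d where "k - c *\<^sub>R w = d *\<^sub>R y"
      unfolding span_breakdown_eq span_singleton by blast
    then have k: "k = c *\<^sub>R w + d *\<^sub>R y" by (simp add: algebra_simps)
    show ?thesis by (simp add: k uw vw uy vy)
  qed
  have dual_coords: "\<phi> = dual_apply \<phi> w *\<^sub>R u + dual_apply \<phi> y *\<^sub>R v" for \<phi>
  proof (rule dual_eqI)
    fix k
    have "dual_apply \<phi> k = dual_apply \<phi> (dual_apply u k *\<^sub>R w + dual_apply v k *\<^sub>R y)"
      using coords by simp
    then show "dual_apply \<phi> k = dual_apply (dual_apply \<phi> w *\<^sub>R u + dual_apply \<phi> y *\<^sub>R v) k"
      by (simp add: mult.commute)
  qed
  show ?thesis
    by (rule that[OF b act_u act_v uw vw uy vy coords dual_coords])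
qed

lemma nonreal_eigenvalue_imp_aff_complex:
  assumes dim: "dim (UNIV :: 'h set) = 2"
    and z: "complex_eigenvalue (ebr X) z" "z \<notin> \<real>"
  shows "lie_isomorphic ebr aff_complex"
proof -
  obtain w y u v a b where b: "b \<noteq> 0"
    and wu: "act w u = a *\<^sub>R u - b *\<^sub>R v" and wv: "act w v = a *\<^sub>R v + b *\<^sub>R u"
    and ev: "dual_apply u w = 1" "dual_apply v w = 0" "dual_apply u y = 0" "dual_apply v y = 1"
    and coords: "\<And>k. k = dual_apply u k *\<^sub>R w + dual_apply v k *\<^sub>R y"
    and dual_coords: "\<And>\<phi>. \<phi> = dual_apply \<phi> w *\<^sub>R u + dual_apply \<phi> y *\<^sub>R v"
    using nonreal_eigenvalue_normal_form[OF dim z] by metis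
  define b11 where "b11 = dual_apply (act y u) w"
  define b12 where "b12 = dual_apply (act y u) y"
  define b21 where "b21 = dual_apply (act y v) w"
  define b22 where "b22 = dual_apply (act y v) y"
  have yu: "act y u = b11 *\<^sub>R u + b12 *\<^sub>R v" and yv: "act y v = b21 *\<^sub>R u + b22 *\<^sub>R v"
    unfolding b11_def b12_def b21_def b22_def by (rule dual_coords)+
  have "dual_apply u (hbr w y) = b11 + b" "dual_apply v (hbr w y) = b21 - a"
    unfolding torsion_free wu wv by (simp_all add: ev b11_def b21_def)
  then have wy: "hbr w y = (b11 + b) *\<^sub>R w + (b21 - a) *\<^sub>R y"
    using coords[of "hbr w y"] by simp
  have rep: "(b11 + b) *\<^sub>R act w \<phi> + (b21 - a) *\<^sub>R act y \<phi> = act w (act y \<phi>) - act y (act w \<phi>)" for \<phi>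
    using act_hbr[of w y \<phi>] by (simp add: wy act_simps)
  note components = arg_cong[OF rep, of dual_apply, THEN fun_cong]
  have eqs: "b * (b12 + b21) = (b11 + b) * a + (b21 - a) * b11"
    "b * (b22 - b11) = - (b11 + b) * b + (b21 - a) * b12"
    "b * (b22 - b11) = (b11 + b) * b + (b21 - a) * b21"
    "- b * (b12 + b21) = (b11 + b) * a + (b21 - a) * b22"
    using components[of u w] components[of u y] components[of v w] components[of v y]
    by (simp_all add: act_simps wu wv yu yv ev algebra_simps)
  note B = flat_torsion_free_complex_action[OF b eqs]
  have wy0: "hbr w y = 0" using wy B(1,2) by simp
  have yu: "act y u = - (b *\<^sub>R u) - a *\<^sub>R v" and yv: "act y v = a *\<^sub>R u - b *\<^sub>R v"
    unfolding yu yv B(3-6) by simp_all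
  (* w acts as the complex number a + i b and y as i times it, with i u = - v; so e = w / (a + i b)
     acts as 1 and j = i e as i *)
  define r where "r = a\<^sup>2 + b\<^sup>2"
  have r: "r \<noteq> 0" using b by (simp add: r_def sum_power2_eq_zero_iff)
  define e where "e = (1 / r) *\<^sub>R (a *\<^sub>R w - b *\<^sub>R y)"
  define j where "j = (1 / r) *\<^sub>R (b *\<^sub>R w + a *\<^sub>R y)"
  note collect = inverse_norm_square_scale[OF r_def r]
  have eu: "act e u = u" and ju: "act j u = - v" and ev': "act e v = v" and jv: "act j v = u"
    using collect[of u] collect[of v] collect[of "- v"]
    by (simp_all add: e_def j_def act_simps wu wv yu yv algebra_simps)
  have e_id: "act e \<phi> = \<phi>" for \<phi>
    by (subst (1 2) dual_coords[of \<phi>]) (simp only: act_simps eu ev')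
  have "hbr y w = 0" using wy0 lie_algebra_anticommute[OF lie_h, of w y] by simp
  then have ej: "hbr e j = 0"
    by (simp add: e_def j_def h_simps wy0)
  (* as e acts as 1 on n, the lift (- n, j) of j commutes with (0, e) *)
  define n where "n = fst (ebr (0, e) (0, j))"
  have n: "ebr (0, e) (0, j) = (n, 0)"
    by (simp add: n_def prod_eq_iff ej)
  show ?thesis
  proof (rule lie_isomorphic_aff_complexI[OF lie_e])
    have "ebr (0, e) (- n, j) = ebr (0, e) ((0, j) + (- n, 0))" by simp
    also have "\<dots> = 0" unfolding e_simps(2) n ebr_dual e_id by (simp add: zero_prod_def)
    finally show "ebr (0, e) (- n, j) = 0" .
    show "ebr (0, e) (u, 0) = (u, 0)" "ebr (0, e) (- v, 0) = (- v, 0)"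
      "ebr (- n, j) (u, 0) = (- v, 0)" "ebr (- n, j) (- v, 0) = - (u, 0)"
      unfolding ebr_dual by (simp_all add: e_id ju jv act_simps)
    show "ebr (u, 0) (- v, 0) = 0" by (rule dual_abelian)
  next
    fix k :: "'h dual \<times> 'h"
    obtain \<phi> x where k: "k = (\<phi>, x)" by (cases k)
    define p where "p = a * dual_apply u x - b * dual_apply v x"
    define q where "q = b * dual_apply u x + a * dual_apply v x"
    have w: "a *\<^sub>R e + b *\<^sub>R j = w" and y: "a *\<^sub>R j - b *\<^sub>R e = y"
      using collect[of w] collect[of y] by (simp_all add: e_def j_def algebra_simps)
    have "x = p *\<^sub>R e + q *\<^sub>R j"
      by (subst coords[of x]) (simp add: p_def q_def algebra_simps flip: w y)
    moreover obtain c d where "\<phi> + q *\<^sub>R n = c *\<^sub>R u + d *\<^sub>R v"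
      using dual_coords by blast
    then have "\<phi> = c *\<^sub>R u + d *\<^sub>R v - q *\<^sub>R n" by (simp add: algebra_simps)
    ultimately have "k = p *\<^sub>R (0, e) + q *\<^sub>R (- n, j) + c *\<^sub>R (u, 0) + (- d) *\<^sub>R (- v, 0)"
      by (simp add: k)
    then show "\<exists>p q r s. k = p *\<^sub>R (0, e) + q *\<^sub>R (- n, j) + r *\<^sub>R (u, 0) + s *\<^sub>R (- v, 0)"
      by blast
  next
    fix p q s t
    assume "p *\<^sub>R (0, e) + q *\<^sub>R (- n, j) + s *\<^sub>R (u, 0) + t *\<^sub>R (- v, 0) = 0"
    then have 1: "p *\<^sub>R e + q *\<^sub>R j = 0" and 2: "- (q *\<^sub>R n) + s *\<^sub>R u - t *\<^sub>R v = 0"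
      by (auto simp: prod_eq_iff)
    have "p *\<^sub>R u - q *\<^sub>R v = 0"
      using arg_cong[OF 1, of "\<lambda>x. act x u"] by (simp add: act_simps e_id ju)
    from arg_cong[OF this, of dual_apply, THEN fun_cong]
    have pq: "p * dual_apply u k = q * dual_apply v k" for k by simp
    from pq[of w] pq[of y] have "p = 0" "q = 0" by (simp_all add: ev)
    moreover from this 2 have "dual_apply (s *\<^sub>R u - t *\<^sub>R v) k = dual_apply 0 k" for k by simp
    from this[of w] this[of y] have "s = 0" "t = 0" by (simp_all add: ev)
    ultimately show "p = 0 \<and> q = 0 \<and> s = 0 \<and> t = 0" by simp
  qed
qed

end

section \<open>Four-dimensional solutions\<close>

theorem theorem3p11:
  fixes br :: "'g::real_vector \<Rightarrow> 'g \<Rightarrow> 'g"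
  assumes "lie_algebra br"
    and "dim (UNIV :: 'g set) = 4"
    and "cotangent_solution TYPE('h::real_vector) br"
  shows "(completely_solvable br \<and> symplectic_lie_algebra br) \<or> lie_isomorphic br aff_complex"
proof (cases "lie_isomorphic br aff_complex")
  case False
  obtain \<omega> and hbr :: "'h \<Rightarrow> 'h \<Rightarrow> 'h" and ebr f where sym: "symplectic_form br \<omega>"
    and ext: "cotangent_extension hbr ebr" and iso: "lie_iso br ebr f"
    using assms(3) unfolding cotangent_solution_def symplectic_cotangent_solution_def by blast
  interpret cotangent_ext hbr ebr using ext by unfold_locales
  have lin: "linear f" and hom: "\<And>x y. f (br x y) = ebr (f x) (f y)" and bij: "bij f"
    using iso by (auto simp: lie_iso_def lie_hom_def)
  have inj0: "f x = 0 \<longleftrightarrow> x = 0" for x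
    using lin bij by (metis bij_is_inj linear_0 injD)
  have dim_h: "dim (UNIV :: 'h set) = 2"
  proof -
    obtain T :: "'g set" where T: "finite T" "span T = UNIV"
      using sym unfolding symplectic_form_def by blast
    have "span (f ` T) = UNIV"
      using linear_span_image[OF lin, of T] T(2) bij by (simp add: bij_is_surj)
    then have "dim (UNIV :: ('h dual \<times> 'h) set) = 2 * dim (UNIV :: 'h set)"
      using T(1) by (intro dim_dual_times[of "f ` T"]) auto
    then show ?thesis
      using dim_UNIV_linear_bij[OF lin bij] assms(2) by simp
  qed
  have "solvable_lie br"
  proof (rule solvable_extension_abelian_kernel[OF assms(1)])
    show "lie_hom br hbr (snd \<circ> f)"
      using lin by (auto simp: lie_hom_def hom intro: linear_compose linear_snd)
    show "solvable_lie hbr" by (rule solvable_dim_2[OF lie_h dim_h])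
    show "br x y = 0" if "(snd \<circ> f) x = 0" "(snd \<circ> f) y = 0" for x y
    proof -
      have "f (br x y) = ebr (fst (f x), 0) (fst (f y), 0)"
        using that unfolding hom by (metis comp_apply prod.collapse)
      then show ?thesis by (simp add: dual_abelian inj0)
    qed
  qed
  moreover have "z \<in> \<real>" if eigen: "complex_eigenvalue (br x) z" for x z
  proof (rule ccontr)
    assume "z \<notin> \<real>"
    obtain p q where "p \<noteq> 0 \<or> q \<noteq> 0"
      "br x p = Re z *\<^sub>R p - Im z *\<^sub>R q" "br x q = Re z *\<^sub>R q + Im z *\<^sub>R p"
      using eigen by (rule complex_eigenvalueE)
    then have "f p \<noteq> 0 \<or> f q \<noteq> 0"
      "ebr (f x) (f p) = Re z *\<^sub>R f p - Im z *\<^sub>R f q" "ebr (f x) (f q) = Re z *\<^sub>R f q + Im z *\<^sub>R f p"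
      by (simp_all only: inj0 linear_diff[OF lin] linear_add[OF lin] linear_scale[OF lin] flip: hom)
    then have "complex_eigenvalue (ebr (f x)) z"
      unfolding complex_eigenvalue_def
      by (intro exI[of _ "(f p, f q)"]) (auto simp: scaleC_complexification_def zero_prod_def)
    then have "lie_isomorphic ebr aff_complex"
      using \<open>z \<notin> \<real>\<close> by (rule nonreal_eigenvalue_imp_aff_complex[OF dim_h])
    moreover have "lie_isomorphic br ebr"
      using iso unfolding lie_isomorphic_def by blast
    ultimately show False using False lie_isomorphic_trans by blast
  qed
  ultimately show ?thesis
    using assms(1) sym unfolding completely_solvable_def symplectic_lie_algebra_def by blast
qed simp

end
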